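(* Let $E\subset\mathbf{R}^2$ be a nondegenerate triangle with barycentric coordinates $\lambda_1^E,\lambda_2^E,\lambda_3^E$. Let $f_\ell^E:[0,1]\to\mathbf{R}$, $\ell=1,\dots,6$, be integrable functions, each with a constant sign. Assume that $f_\ell^E\neq 0$ almost everywhere and that $$f_\ell^E(0)=0,\qquad \ell=1,\dots,6.$$ Then, for any choice of the parameters $\mu\ge 0$ and $\alpha,\beta>-1$, the enrichment functions $$\widetilde{\lambda}_k^E(\mathbf{x})=\omega^E_{\mu,\alpha,\beta}(\mathbf{x})\,f_{2k-1}^E\left(\lambda_{k+1}^E(\mathbf{x})\right)f_{2k}^E\left(\lambda_{k+2}^E(\mathbf{x})\right),\qquad k=1,2,3,$$ are admissible.
   Context: Notation. $E$ is a (closed) triangle with vertices $\mathbf{v}_1^E,\mathbf{v}_2^E,\mathbf{v}_3^E$; $\mathbf{e}_j^E$ is the edge opposite to $\mathbf{v}_j^E$ and $|\mathbf{e}_j^E|$ its length. The barycentric coordinates $\lambda_i^E$ are the affine functions with $\lambda_i^E(\mathbf{v}_j^E)=\delta_{ij}$. Indices are cyclic modulo 3: $\mathbf{v}_4^E=\mathbf{v}_1^E$, $\mathbf{v}_5^E=\mathbf{v}_2^E$, $\lambda_4^E=\lambda_1^E$, $\lambda_5^E=\lambda_2^E$. A function has constant sign if it is everywhere $\ge 0$ or everywhere $\le 0$. Weight function. For $\mu\ge 0$, $\alpha,\beta>-1$, $$\omega^E_{\mu,\alpha,\beta}(\mathbf{x})=\sum_{j=1}^{3}\left(1-\lambda_j^E(\mathbf{x})\right)^{\mu}\left(\lambda_{j+1}^E(\mathbf{x})\right)^{\alpha}\left(\lambda_{j+2}^E(\mathbf{x})\right)^{\beta}.$$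 Its restriction to each edge is taken to be the Jacobi weight: $\omega^E_{\mu,\alpha,\beta}(t\mathbf{v}_{j+1}^E+(1-t)\mathbf{v}_{j+2}^E)=t^{\alpha}(1-t)^{\beta}$ for $t\in(0,1)$, $j=1,2,3$ (for $\alpha,\beta>0$ this follows from the formula; otherwise it is the convention used to evaluate the weight on the edges). At a vertex, the product of the weight with factors one of which is zero is understood to be $0$. Linear functionals. $\mathcal{L}_i(v)=v(\mathbf{v}_i^E)$ and $\widetilde{\mathcal{L}}_j(v)=\frac{1}{|\mathbf{e}_j^E|}\int_{\mathbf{e}_j^E}v\,d\mathbf{x}$ (arc-length integral), $i,j=1,2,3$. Functions are considered pointwise on $E$. Standing assumption: all these functionals are well defined (in particular the edge integrals are finite) on the linear span of $\lambda_1^E,\lambda_2^E,\lambda_3^E$ and the enrichment functions $\widetilde{\lambda}_1^E,\widetilde{\lambda}_2^E,\widetilde{\lambda}_3^E$. Admissibility. Let $P^1(E)$ be the polynomials of degree at most one on $E$. Three functions $\widetilde{\lambda}_1^E,\widetilde{\lambda}_2^E,\widetilde{\lambda}_3^E$ on $E$ are called admissible if they are linearly independent, $P^1(E)\cap\operatorname{span}\{\widetilde{\lambda}_1^E,\widetilde{\lambda}_2^E,\widetilde{\lambda}_3^E\}=\{0\}$, and the 6-dimensional space $V_h(E)=P^1(E)\oplus\operatorname{span}\{\widetilde{\lambda}_1^E,\widetilde{\lambda}_2^E,\widetilde{\lambda}_3^E\}$ has a basis $\varphi_1^E,\dots,\varphi_6^E$ such that, for all $i,j,r,s\in\{1,2,3\}$,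 $\mathcal{L}_r(\varphi_i^E)=\delta_{ir}$, $\widetilde{\mathcal{L}}_s(\varphi_i^E)=0$, $\mathcal{L}_r(\varphi_{j+3}^E)=0$, $\widetilde{\mathcal{L}}_s(\varphi_{j+3}^E)=\delta_{js}$. *)

theory Defs
  imports "HOL-Analysis.Analysis" "HOL-Library.Function_Algebras"
begin

text \<open>
  Linear algebra of real-valued functions. The operations on functions are pointwise (addition and
  zero from \<^theory>\<open>HOL-Library.Function_Algebras\<close>), so that \<open>fun_space.span\<close>,
  \<open>fun_space.independent\<close> etc. are the library notions for the real vector space of all
  functions.
\<close>

definition fun_scale :: "real \<Rightarrow> ('a \<Rightarrow> real) \<Rightarrow> 'a \<Rightarrow> real" where
  "fun_scale c g = (\<lambda>x. c * g x)"

interpretation fun_space: vector_space fun_scale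
  by unfold_locales (auto simp: fun_scale_def fun_eq_iff algebra_simps)

text \<open>
  A function on \<open>S\<close> is represented by its extension by zero, so that equality of the
  representatives is pointwise equality on \<open>S\<close>.
\<close>

definition on_set :: "'a set \<Rightarrow> ('a \<Rightarrow> real) \<Rightarrow> 'a \<Rightarrow> real" where
  "on_set S g = (\<lambda>x. if x \<in> S then g x else 0)"

text \<open>
  The vertices of a triangle are \<open>v 1, v 2, v 3\<close>; \<open>cyc\<close> reduces an index modulo 3 into
  \<open>{1, 2, 3}\<close>. Only these values of \<open>v\<close> are ever used.
\<close>

definition cyc :: "nat \<Rightarrow> nat" where
  "cyc i = (i - 1) mod 3 + 1"

definition triangle :: "(nat \<Rightarrow> real^2) \<Rightarrow> (real^2) set" where
  "triangle v = convex hull (v ` {1..3})"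

definition nondegenerate :: "(nat \<Rightarrow> real^2) \<Rightarrow> bool" where
  "nondegenerate v \<longleftrightarrow> \<not> collinear (v ` {1..3})"

definition affine_fun :: "(real^2 \<Rightarrow> real) \<Rightarrow> bool" where
  "affine_fun g \<longleftrightarrow> (\<exists>a b. \<forall>x. g x = a \<bullet> x + b)"

definition bary :: "(nat \<Rightarrow> real^2) \<Rightarrow> nat \<Rightarrow> real^2 \<Rightarrow> real" where
  "bary v i = (THE g. affine_fun g \<and> (\<forall>j\<in>{1..3}. g (v j) = (if cyc i = j then 1 else 0)))"

text \<open>
  Since \<open>0 powr a = 0\<close> for every \<open>a\<close>, the formula below already takes the conventional values on
  the boundary: the Jacobi weight on every open edge, for all \<open>\<alpha>\<close> and \<open>\<beta>\<close> (lemma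
  \<open>weight_edge\<close>), and 0 at the vertices. In the interior of the triangle all bases are positive.
\<close>

definition weight :: "(nat \<Rightarrow> real^2) \<Rightarrow> real \<Rightarrow> real \<Rightarrow> real \<Rightarrow> real^2 \<Rightarrow> real" where
  "weight v \<mu> \<alpha> \<beta> x =
     (\<Sum>j=1..3. (1 - bary v j x) powr \<mu> * bary v (j + 1) x powr \<alpha> * bary v (j + 2) x powr \<beta>)"

definition vertex_value :: "(nat \<Rightarrow> real^2) \<Rightarrow> nat \<Rightarrow> (real^2 \<Rightarrow> real) \<Rightarrow> real" where
  "vertex_value v i g = g (v i)"

text \<open>Edge \<open>j\<close> is opposite to vertex \<open>j\<close>; integrals over it use its arc-length parametrization.\<close>

definition edge_length :: "(nat \<Rightarrow> real^2) \<Rightarrow> nat \<Rightarrow> real" where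
  "edge_length v j = dist (v (cyc (j + 1))) (v (cyc (j + 2)))"

definition edge_path :: "(nat \<Rightarrow> real^2) \<Rightarrow> nat \<Rightarrow> real \<Rightarrow> real^2" where
  "edge_path v j s =
     v (cyc (j + 1)) + (s / edge_length v j) *\<^sub>R (v (cyc (j + 2)) - v (cyc (j + 1)))"

definition edge_integrable :: "(nat \<Rightarrow> real^2) \<Rightarrow> nat \<Rightarrow> (real^2 \<Rightarrow> real) \<Rightarrow> bool" where
  "edge_integrable v j g \<longleftrightarrow>
     integrable (lebesgue_on {0..edge_length v j}) (\<lambda>s. g (edge_path v j s))"

definition edge_mean :: "(nat \<Rightarrow> real^2) \<Rightarrow> nat \<Rightarrow> (real^2 \<Rightarrow> real) \<Rightarrow> real" where
  "edge_mean v j g =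
     1 / edge_length v j *
     integral\<^sup>L (lebesgue_on {0..edge_length v j}) (\<lambda>s. g (edge_path v j s))"

definition P1 :: "(nat \<Rightarrow> real^2) \<Rightarrow> (real^2 \<Rightarrow> real) set" where
  "P1 v = {on_set (triangle v) g | g. affine_fun g}"

definition enrichment_span ::
  "(nat \<Rightarrow> real^2) \<Rightarrow> (nat \<Rightarrow> real^2 \<Rightarrow> real) \<Rightarrow> (real^2 \<Rightarrow> real) set" where
  "enrichment_span v e = fun_space.span ((\<lambda>k. on_set (triangle v) (e k)) ` {1..3})"

definition V_h ::
  "(nat \<Rightarrow> real^2) \<Rightarrow> (nat \<Rightarrow> real^2 \<Rightarrow> real) \<Rightarrow> (real^2 \<Rightarrow> real) set" where
  "V_h v e = {p + q | p q. p \<in> P1 v \<and> q \<in> enrichment_span v e}"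

definition functionals_well_defined ::
  "(nat \<Rightarrow> real^2) \<Rightarrow> (nat \<Rightarrow> real^2 \<Rightarrow> real) \<Rightarrow> bool" where
  "functionals_well_defined v e \<longleftrightarrow>
     (\<forall>g \<in> fun_space.span ((\<lambda>i. on_set (triangle v) (bary v i)) ` {1..3} \<union>
                           (\<lambda>k. on_set (triangle v) (e k)) ` {1..3}).
        \<forall>j\<in>{1..3}. edge_integrable v j g)"

text \<open>Linear independence of a finite family, as opposed to that of its set of values.\<close>

definition lin_indep_family :: "nat set \<Rightarrow> (nat \<Rightarrow> 'a \<Rightarrow> real) \<Rightarrow> bool" where
  "lin_indep_family I g \<longleftrightarrow> inj_on g I \<and> fun_space.independent (g ` I)"

definition admissible :: "(nat \<Rightarrow> real^2) \<Rightarrow> (nat \<Rightarrow> real^2 \<Rightarrow> real) \<Rightarrow> bool" where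
  "admissible v e \<longleftrightarrow>
     lin_indep_family {1..3} (\<lambda>k. on_set (triangle v) (e k)) \<and>
     P1 v \<inter> enrichment_span v e = {0} \<and>
     (\<exists>\<phi>. lin_indep_family {1..6} \<phi> \<and> fun_space.span (\<phi> ` {1..6}) = V_h v e \<and>
        (\<forall>i\<in>{1..3}. \<forall>j\<in>{1..3}. \<forall>r\<in>{1..3}. \<forall>s\<in>{1..3}.
           vertex_value v r (\<phi> i) = (if i = r then 1 else 0) \<and>
           edge_mean v s (\<phi> i) = 0 \<and>
           vertex_value v r (\<phi> (j + 3)) = 0 \<and>
           edge_mean v s (\<phi> (j + 3)) = (if j = s then 1 else 0)))"

definition constant_sign_on :: "'a set \<Rightarrow> ('a \<Rightarrow> real) \<Rightarrow> bool" where
  "constant_sign_on S g \<longleftrightarrow> (\<forall>t\<in>S. 0 \<le> g t) \<or> (\<forall>t\<in>S. g t \<le> 0)"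

definition enrichment ::
  "(nat \<Rightarrow> real^2) \<Rightarrow> real \<Rightarrow> real \<Rightarrow> real \<Rightarrow> (nat \<Rightarrow> real \<Rightarrow> real) \<Rightarrow> nat \<Rightarrow> real^2 \<Rightarrow> real" where
  "enrichment v \<mu> \<alpha> \<beta> f k x =
     weight v \<mu> \<alpha> \<beta> x * f (2 * k - 1) (bary v (k + 1) x) * f (2 * k) (bary v (k + 2) x)"


subsection \<open>The barycentric coordinates and the weight on the edges\<close>

lemma atLeastAtMost_1_3: "{1..3} = {1, 2, 3::nat}" "{Suc 0..3} = {1, 2, 3}"
  by auto

lemma cyc_simps [simp]:
  "cyc (Suc 0) = 1" "cyc 1 = 1" "cyc 2 = 2" "cyc 3 = 3" "cyc 4 = 1" "cyc 5 = 2"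
  by (simp_all add: cyc_def)

lemma cyc_in: "cyc i \<in> {1..3}"
proof -
  have "(i - 1) mod 3 < 3" by simp
  then show ?thesis unfolding cyc_def by (simp add: Suc_le_eq)
qed

lemma collinear_if_cross_0:
  fixes a b c :: "real^2"
  assumes "(b$1 - a$1) * (c$2 - a$2) = (b$2 - a$2) * (c$1 - a$1)"
  shows "collinear {a, b, c}"
proof -
  have "collinear {0, b - a, c - a}"
  proof (cases "b - a = 0")
    case False
    then have "\<exists>k. c - a = k *\<^sub>R (b - a)"
    proof (cases "b$1 - a$1 = 0")
      case True
      with False have 2: "b$2 - a$2 \<noteq> 0"
        by (auto simp: vec_eq_iff forall_2)
      with True assms have "c$1 - a$1 = 0" by simp
      with True 2 show ?thesis
        by (intro exI[of _ "(c$2 - a$2) / (b$2 - a$2)"]) (simp add: vec_eq_iff forall_2)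
    next
      case False
      then have "c$2 - a$2 = ((c$1 - a$1) / (b$1 - a$1)) * (b$2 - a$2)"
        using assms by (simp add: nonzero_eq_divide_eq mult.commute)
      with False show ?thesis
        by (intro exI[of _ "(c$1 - a$1) / (b$1 - a$1)"]) (simp add: vec_eq_iff forall_2)
    qed
    then show ?thesis by (auto simp: collinear_lemma)
  qed (simp add: collinear_lemma)
  then show ?thesis
    using collinear_3[of b a c] by (simp add: insert_commute)
qed

lemma bary_ex1:
  assumes "nondegenerate v"
  shows "\<exists>!g. affine_fun g \<and> (\<forall>j\<in>{1..3}. g (v j) = (if cyc i = j then 1 else 0))"
proof -
  define D where "D = (v 2$1 - v 1$1) * (v 3$2 - v 1$2) - (v 2$2 - v 1$2) * (v 3$1 - v 1$1)"
  have D: "D \<noteq> 0"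
    using assms collinear_if_cross_0[of "v 2" "v 1" "v 3"]
    unfolding nondegenerate_def atLeastAtMost_1_3 D_def by auto
  have unique: "g = h" if "affine_fun g" "affine_fun h" "\<forall>j\<in>{1..3}. g (v j) = h (v j)" for g h
  proof -
    obtain a b where g: "\<And>x. g x = a \<bullet> x + b" using \<open>affine_fun g\<close> by (auto simp: affine_fun_def)
    obtain a' b' where h: "\<And>x. h x = a' \<bullet> x + b'"
      using \<open>affine_fun h\<close> by (auto simp: affine_fun_def)
    define p q where "p = a$1 - a'$1" and "q = a$2 - a'$2"
    have e: "p * v j$1 + q * v j$2 = b' - b" if "j \<in> {1..3}" for j
      using bspec[OF \<open>\<forall>j\<in>{1..3}. g (v j) = h (v j)\<close> that]
      by (simp add: g h inner_vec_def sum_2 p_def q_def algebra_simps)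
    have e2: "p * (v 2$1 - v 1$1) + q * (v 2$2 - v 1$2) = 0"
      using e[of 1] e[of 2] by (simp add: algebra_simps)
    have e3: "p * (v 3$1 - v 1$1) + q * (v 3$2 - v 1$2) = 0"
      using e[of 1] e[of 3] by (simp add: algebra_simps)
    have "p * D = 0" "q * D = 0"
      unfolding D_def using e2 e3 by algebra+
    with D have "p = 0" "q = 0" by simp_all
    then have "b = b'" "a = a'"
      using e[of 1] by (simp_all add: p_def q_def vec_eq_iff forall_2)
    then show "g = h" by (simp add: fun_eq_iff g h)
  qed
  have affI: "affine_fun (\<lambda>x. (c * (x$1 - y$1) + d * (x$2 - y$2)) / D)" for c d and y :: "real^2"
    unfolding affine_fun_def
    by (intro exI[of _ "vector [c / D, d / D]"] exI[of _ "- (c * y$1 + d * y$2) / D"])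
      (simp add: inner_vec_def sum_2 field_simps D)
  have cases: "cyc i = 1 \<or> cyc i = 2 \<or> cyc i = 3"
    using cyc_in[of i] by auto
  have "\<exists>g. affine_fun g \<and> (\<forall>j\<in>{1..3}. g (v j) = (if cyc i = j then 1 else 0))"
    using cases
  proof (elim disjE)
    assume "cyc i = 1"
    then show ?thesis
      using D affI[where c = "v 2$2 - v 3$2" and d = "v 3$1 - v 2$1" and y = "v 2"]
      by (intro exI[of _ "\<lambda>x. ((v 2$2 - v 3$2) * (x$1 - v 2$1) + (v 3$1 - v 2$1) * (x$2 - v 2$2)) / D"])
        (auto simp: atLeastAtMost_1_3 divide_eq_eq D_def algebra_simps)
  next
    assume "cyc i = 2"
    then show ?thesis
      using D affI[where c = "v 3$2 - v 1$2" and d = "v 1$1 - v 3$1" and y = "v 3"]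
      by (intro exI[of _ "\<lambda>x. ((v 3$2 - v 1$2) * (x$1 - v 3$1) + (v 1$1 - v 3$1) * (x$2 - v 3$2)) / D"])
        (auto simp: atLeastAtMost_1_3 divide_eq_eq D_def algebra_simps)
  next
    assume "cyc i = 3"
    then show ?thesis
      using D affI[where c = "v 1$2 - v 2$2" and d = "v 2$1 - v 1$1" and y = "v 1"]
      by (intro exI[of _ "\<lambda>x. ((v 1$2 - v 2$2) * (x$1 - v 1$1) + (v 2$1 - v 1$1) * (x$2 - v 1$2)) / D"])
        (auto simp: atLeastAtMost_1_3 divide_eq_eq D_def algebra_simps)
  qed
  with unique show ?thesis by (metis (mono_tags, lifting))
qed

lemma
  assumes "nondegenerate v"
  shows affine_bary: "affine_fun (bary v i)"
    and bary_vertex: "j \<in> {1..3} \<Longrightarrow> bary v i (v j) = (if cyc i = j then 1 else 0)"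
  using theI'[OF bary_ex1[OF assms, of i]] unfolding bary_def[symmetric] by blast+

lemma bary_edge:
  assumes "nondegenerate v" "a \<in> {1..3}" "b \<in> {1..3}"
  shows "bary v i (t *\<^sub>R v a + (1 - t) *\<^sub>R v b) =
           t * (if cyc i = a then 1 else 0) + (1 - t) * (if cyc i = b then 1 else 0)"
proof -
  obtain c d where g: "\<And>x. bary v i x = c \<bullet> x + d"
    using affine_bary[OF assms(1), of i] by (auto simp: affine_fun_def)
  have "bary v i (t *\<^sub>R v a + (1 - t) *\<^sub>R v b) = t * bary v i (v a) + (1 - t) * bary v i (v b)"
    by (simp add: g inner_right_distrib algebra_simps)
  then show ?thesis
    using bary_vertex[OF assms(1,2)] bary_vertex[OF assms(1,3)] by simp
qed

lemma weight_edge: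
  assumes "nondegenerate v" "j \<in> {1..3}" "0 < t" "t < 1"
  shows "weight v \<mu> \<alpha> \<beta> (t *\<^sub>R v (cyc (j + 1)) + (1 - t) *\<^sub>R v (cyc (j + 2))) =
           t powr \<alpha> * (1 - t) powr \<beta>"
proof -
  have "j = 1 \<or> j = 2 \<or> j = 3" using assms(2) by auto
  with assms(3,4) show ?thesis
    by (auto simp: weight_def atLeastAtMost_1_3 bary_edge[OF assms(1)] cyc_def)
qed

lemma weight_vertex:
  assumes "nondegenerate v" "i \<in> {1..3}"
  shows "weight v \<mu> \<alpha> \<beta> (v i) = 0"
proof -
  have "i = 1 \<or> i = 2 \<or> i = 3" using assms(2) by auto
  then show ?thesis
    by (elim disjE) (simp_all add: weight_def atLeastAtMost_1_3 bary_vertex[OF assms(1)] cyc_def)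
qed

end

theory Submission
  imports Defs
begin

text \<open>
  Three vertex values and three edge means are six linear functionals on the span of the barycentric
  coordinates \<open>\<lambda>\<^sub>i\<close> and the enrichment functions \<open>e\<^sub>k\<close>. Admissibility holds because these functionals
  are block triangular with respect to this spanning family.

  The weight vanishes at the vertices, hence so does every \<open>e\<^sub>k\<close>, while the vertex values of the
  \<open>\<lambda>\<^sub>i\<close> form the identity matrix. On edge \<open>j\<close>, where \<open>\<lambda>\<^sub>j = 0\<close>, each \<open>e\<^sub>k\<close> with \<open>k \<noteq> j\<close> contains a
  factor \<open>f\<^sub>l(\<lambda>\<^sub>j) = f\<^sub>l(0) = 0\<close>, so only \<open>e\<^sub>j\<close> survives (\<open>edge_mean_other_enrichment\<close>). There
  \<open>e\<^sub>j\<close> is the positive Jacobi weight times \<open>f\<^sub>2\<^sub>j\<^sub>-\<^sub>1(t) f\<^sub>2\<^sub>j(1 - t)\<close>; this integrable function has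
  a constant sign and is nonzero almost everywhere, so its mean is not zero
  (\<open>edge_mean_own_enrichment_ne_0\<close>). Thus the edge means of the \<open>e\<^sub>k\<close> form an invertible diagonal
  matrix.

  Dividing each \<open>e\<^sub>k\<close> by its mean, and then subtracting from each \<open>\<lambda>\<^sub>i\<close> the combination of these
  that matches its edge means, produces the dual basis (\<open>dual_basis_of_block_triangular\<close>). Finally
  an affine function in the span of the \<open>e\<^sub>k\<close> vanishes at the vertices and is therefore zero, so the
  sum of the two spaces is direct.
\<close>

section \<open>Bases dual to block triangular functionals\<close>

definition linear_functional_on :: "('a \<Rightarrow> real) set \<Rightarrow> (('a \<Rightarrow> real) \<Rightarrow> real) \<Rightarrow> bool" where
  "linear_functional_on W L \<longleftrightarrow>
     (\<forall>g\<in>W. \<forall>h\<in>W. L (g + h) = L g + L h) \<and> (\<forall>c. \<forall>g\<in>W. L (fun_scale c g) = c * L g)"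

lemma linear_functional_on_diff:
  assumes "linear_functional_on W L" "fun_space.subspace W" "g \<in> W" "h \<in> W"
  shows "L (g - h) = L g - L h"
proof -
  have "g - h = g + fun_scale (-1) h"
    by (simp add: fun_eq_iff fun_scale_def)
  moreover have "L (fun_scale (-1) h) = - L h"
    using assms(1,4) unfolding linear_functional_on_def by (metis mult_minus1)
  moreover have "fun_scale (-1) h \<in> W"
    using assms(2,4) by (rule fun_space.subspace_scale)
  ultimately show ?thesis
    using assms(1,3) unfolding linear_functional_on_def by auto
qed

lemma linear_functional_on_sum:
  assumes "linear_functional_on W L" "fun_space.subspace W" "finite J" "\<And>j. j \<in> J \<Longrightarrow> g j \<in> W"
  shows "L (\<Sum>j\<in>J. fun_scale (u j) (g j)) = (\<Sum>j\<in>J. u j * L (g j))"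
  using assms(3,4)
proof (induction J rule: finite_induct)
  case empty
  have "L (fun_scale 0 0) = 0 * L 0"
    using assms(1) fun_space.subspace_0[OF assms(2)] unfolding linear_functional_on_def by blast
  then show ?case by (simp add: fun_scale_def zero_fun_def)
next
  case (insert j J)
  have "fun_scale (u j) (g j) \<in> W" "(\<Sum>j\<in>J. fun_scale (u j) (g j)) \<in> W"
    using insert.prems
    by (auto intro!: fun_space.subspace_sum[OF assms(2)] fun_space.subspace_scale[OF assms(2)])
  then have step: "L (fun_scale (u j) (g j) + (\<Sum>j\<in>J. fun_scale (u j) (g j))) =
      u j * L (g j) + L (\<Sum>j\<in>J. fun_scale (u j) (g j))"
    using insert.prems assms(1) unfolding linear_functional_on_def by auto
  have "L (\<Sum>j\<in>J. fun_scale (u j) (g j)) = (\<Sum>j\<in>J. u j * L (g j))"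
    using insert.prems by (intro insert.IH) auto
  with step show ?case
    unfolding sum.insert[OF insert.hyps] by (simp only:)
qed

lemma linear_functional_on_vanishes_on_span:
  assumes "linear_functional_on W L" "fun_space.subspace W" "S \<subseteq> W" "\<And>x. x \<in> S \<Longrightarrow> L x = 0"
    and "g \<in> fun_space.span S"
  shows "L g = 0"
proof -
  obtain J u where "finite J" "J \<subseteq> S" "g = (\<Sum>x\<in>J. fun_scale (u x) x)"
    using assms(5) unfolding fun_space.span_explicit by auto
  then show ?thesis
    using linear_functional_on_sum[OF assms(1,2), of J "\<lambda>x. x" u] assms(3,4)
    by (simp add: subset_iff)
qed

text \<open>
  Applying the \<open>r\<close>-th functional to a linear relation isolates its \<open>r\<close>-th coefficient. Linearity
  is relative to a subspace \<open>W\<close>, since edge means are additive on functions that are integrable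
  over the edge but not on all functions.
\<close>

lemma lin_indep_family_if_dual:
  assumes "finite I" "fun_space.subspace W" "\<And>i. i \<in> I \<Longrightarrow> \<phi> i \<in> W"
    and "\<And>r. r \<in> I \<Longrightarrow> linear_functional_on W (L r)"
    and "\<And>i r. i \<in> I \<Longrightarrow> r \<in> I \<Longrightarrow> L r (\<phi> i) = (if i = r then 1 else 0)"
  shows "lin_indep_family I \<phi>"
proof -
  have inj: "inj_on \<phi> I"
    using assms(5) by (intro inj_onI) (metis zero_neq_one)
  have "u (\<phi> r) = 0" if "(\<Sum>x\<in>\<phi> ` I. fun_scale (u x) x) = 0" "r \<in> I" for u r
  proof -
    have "L r (\<Sum>i\<in>I. fun_scale (u (\<phi> i)) (\<phi> i)) = (\<Sum>i\<in>I. u (\<phi> i) * L r (\<phi> i))"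
      using linear_functional_on_sum[OF assms(4)[OF that(2)] assms(2,1), of \<phi> "\<lambda>i. u (\<phi> i)"]
        assms(3) by simp
    also have "\<dots> = (\<Sum>i\<in>I. if i = r then u (\<phi> i) else 0)"
      using that(2) assms(5) by (intro sum.cong) auto
    also have "\<dots> = u (\<phi> r)"
      using that(2) assms(1) by simp
    finally have "L r 0 = u (\<phi> r)"
      using that(1) inj by (simp add: sum.reindex)
    moreover have "L r 0 = 0"
      using linear_functional_on_sum[OF assms(4)[OF that(2)] assms(2), of "{}"] by simp
    ultimately show ?thesis by simp
  qed
  then have "fun_space.independent (\<phi> ` I)"
    using assms(1) by (intro fun_space.independent_if_scalars_zero) auto
  with inj show ?thesis by (simp add: lin_indep_family_def)
qed

text \<open>
  In the order \<open>p, q\<close> the \<open>V\<close> block is \<open>(I 0)\<close> and the \<open>M\<close> block is \<open>(A D)\<close> with \<open>D\<close> diagonal and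
  invertible. One step of elimination inverts this matrix: \<open>q\<^sub>j\<close> is scaled by \<open>1 / D\<^sub>j\<^sub>j\<close>, and the
  scaled functions are then used to clear \<open>A\<close>. The latter does not disturb the \<open>V\<close> block, because
  \<open>V\<close> vanishes on the \<open>q\<^sub>j\<close>. Both operations are invertible, so the span stays the same.
\<close>

lemma dual_basis_of_block_triangular:
  fixes p q :: "nat \<Rightarrow> 'a \<Rightarrow> real" and n :: nat
  defines "W \<equiv> fun_space.span (p ` {1..n} \<union> q ` {1..n})"
  assumes linV: "\<And>r. r \<in> {1..n} \<Longrightarrow> linear_functional_on W (V r)"
    and linM: "\<And>s. s \<in> {1..n} \<Longrightarrow> linear_functional_on W (M s)"
    and Vp: "\<And>i r. i \<in> {1..n} \<Longrightarrow> r \<in> {1..n} \<Longrightarrow> V r (p i) = (if i = r then 1 else 0)"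
    and Vq: "\<And>k r. k \<in> {1..n} \<Longrightarrow> r \<in> {1..n} \<Longrightarrow> V r (q k) = 0"
    and Mq: "\<And>k s. k \<in> {1..n} \<Longrightarrow> s \<in> {1..n} \<Longrightarrow> M s (q k) = 0 \<longleftrightarrow> k \<noteq> s"
  shows "lin_indep_family {1..n} q"
    and "\<exists>\<phi>. lin_indep_family {1..2 * n} \<phi> \<and> fun_space.span (\<phi> ` {1..2 * n}) = W \<and>
           (\<forall>i\<in>{1..n}. \<forall>r\<in>{1..n}.
              V r (\<phi> i) = (if i = r then 1 else 0) \<and> M r (\<phi> i) = 0 \<and>
              V r (\<phi> (i + n)) = 0 \<and> M r (\<phi> (i + n)) = (if i = r then 1 else 0))"
proof -
  have W: "fun_space.subspace W"
    unfolding W_def by (rule fun_space.subspace_span)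
  have pW: "p i \<in> W" and qW: "q i \<in> W" if "i \<in> {1..n}" for i
    unfolding W_def using that by (auto intro!: fun_space.span_base)
  define \<psi> where "\<psi> j = fun_scale (1 / M j (q j)) (q j)" for j
  define \<eta> where "\<eta> i = p i - (\<Sum>j\<in>{1..n}. fun_scale (M j (p i)) (\<psi> j))" for i
  have \<psi>W: "\<psi> i \<in> W" if "i \<in> {1..n}" for i
    unfolding \<psi>_def by (intro fun_space.subspace_scale[OF W] qW that)
  have sumW: "(\<Sum>j\<in>{1..n}. fun_scale (c j) (\<psi> j)) \<in> W" for c
    by (intro fun_space.subspace_sum[OF W] fun_space.subspace_scale[OF W] \<psi>W)
  have \<eta>W: "\<eta> i \<in> W" if "i \<in> {1..n}" for i
    unfolding \<eta>_def by (intro fun_space.subspace_diff[OF W] pW sumW that)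
  have V\<psi>: "V r (\<psi> j) = 0" and M\<psi>: "M r (\<psi> j) = (if j = r then 1 else 0)"
    if "j \<in> {1..n}" "r \<in> {1..n}" for j r
    using linV[OF that(2)] linM[OF that(2)] qW[OF that(1)] Vq[OF that] Mq[OF that] Mq[OF that(1,1)]
    unfolding \<psi>_def linear_functional_on_def by auto
  have V\<eta>: "V r (\<eta> i) = (if i = r then 1 else 0)" and M\<eta>: "M r (\<eta> i) = 0"
    if "i \<in> {1..n}" "r \<in> {1..n}" for i r
  proof -
    show "V r (\<eta> i) = (if i = r then 1 else 0)"
      unfolding \<eta>_def
      using linear_functional_on_diff[OF linV[OF that(2)] W pW[OF that(1)] sumW]
        linear_functional_on_sum[OF linV[OF that(2)] W, of "{1..n}" \<psi>] \<psi>W V\<psi>[OF _ that(2)]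
        Vp[OF that] by simp
    have "(\<Sum>j\<in>{1..n}. M j (p i) * M r (\<psi> j)) = (\<Sum>j\<in>{1..n}. if j = r then M j (p i) else 0)"
      using M\<psi> that(2) by (intro sum.cong) auto
    also have "\<dots> = M r (p i)"
      using that(2) by simp
    finally show "M r (\<eta> i) = 0"
      unfolding \<eta>_def
      using linear_functional_on_diff[OF linM[OF that(2)] W pW[OF that(1)] sumW]
        linear_functional_on_sum[OF linM[OF that(2)] W, of "{1..n}" \<psi>] \<psi>W by simp
  qed
  show "lin_indep_family {1..n} q"
  proof (rule lin_indep_family_if_dual[OF _ W qW])
    show "linear_functional_on W (\<lambda>g. M s g / M s (q s))" if "s \<in> {1..n}" for s
      using linM[OF that] unfolding linear_functional_on_def by (simp add: add_divide_distrib)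
    show "M s (q k) / M s (q s) = (if k = s then 1 else 0)" if "k \<in> {1..n}" "s \<in> {1..n}" for k s
      using Mq[OF that] Mq[OF that(2,2)] by auto
  qed auto
  define \<phi> where "\<phi> i = (if i \<le> n then \<eta> i else \<psi> (i - n))" for i
  define F where "F r = (if r \<le> n then V r else M (r - n))" for r
  have idx: "i \<le> n \<and> i \<in> {1..n} \<or> \<not> i \<le> n \<and> i - n \<in> {1..n}" if "i \<in> {1..2 * n}" for i
    using that by auto
  have \<phi>W: "\<phi> i \<in> W" if "i \<in> {1..2 * n}" for i
    using idx[OF that] by (elim disjE) (simp_all add: \<phi>_def \<eta>W \<psi>W)
  have "lin_indep_family {1..2 * n} \<phi>"
  proof (rule lin_indep_family_if_dual[OF _ W \<phi>W])
    show "linear_functional_on W (F r)" if "r \<in> {1..2 * n}" for r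
      using idx[OF that] by (elim disjE) (simp_all add: F_def linV linM)
    show "F r (\<phi> i) = (if i = r then 1 else 0)" if "i \<in> {1..2 * n}" "r \<in> {1..2 * n}" for i r
      using idx[OF that(1)] idx[OF that(2)]
      by (elim disjE) (auto simp add: F_def \<phi>_def V\<eta> M\<eta> V\<psi> M\<psi>)
  qed auto
  moreover have "fun_space.span (\<phi> ` {1..2 * n}) = W"
  proof (rule antisym)
    show "fun_space.span (\<phi> ` {1..2 * n}) \<subseteq> W"
      using \<phi>W by (intro fun_space.span_minimal W) blast
    let ?S = "fun_space.span (\<phi> ` {1..2 * n})"
    have \<psi>S: "\<psi> j \<in> ?S" if "j \<in> {1..n}" for j
      using that by (intro fun_space.span_base image_eqI[of _ _ "j + n"]) (auto simp: \<phi>_def)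
    have \<eta>S: "\<eta> j \<in> ?S" if "j \<in> {1..n}" for j
      using that by (intro fun_space.span_base image_eqI[of _ _ "j"]) (auto simp: \<phi>_def)
    have "q j \<in> ?S" if "j \<in> {1..n}" for j
    proof -
      have "q j = fun_scale (M j (q j)) (\<psi> j)"
        using Mq[OF that that] by (simp add: \<psi>_def fun_scale_def fun_eq_iff)
      then show ?thesis
        using fun_space.span_scale[OF \<psi>S[OF that]] by metis
    qed
    moreover have "p i \<in> ?S" if "i \<in> {1..n}" for i
    proof -
      have "p i = \<eta> i + (\<Sum>j\<in>{1..n}. fun_scale (M j (p i)) (\<psi> j))"
        by (simp add: \<eta>_def)
      also have "\<dots> \<in> ?S"
        by (intro fun_space.span_add fun_space.span_sum fun_space.span_scale \<psi>S \<eta>S that)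
      finally show ?thesis .
    qed
    ultimately show "W \<subseteq> ?S"
      unfolding W_def by (intro fun_space.span_minimal) auto
  qed
  moreover have "V r (\<phi> i) = (if i = r then 1 else 0) \<and> M r (\<phi> i) = 0 \<and>
      V r (\<phi> (i + n)) = 0 \<and> M r (\<phi> (i + n)) = (if i = r then 1 else 0)"
    if "i \<in> {1..n}" "r \<in> {1..n}" for i r
    using that V\<eta>[OF that] M\<eta>[OF that] V\<psi>[OF that] M\<psi>[OF that] by (auto simp: \<phi>_def)
  ultimately show "\<exists>\<phi>. lin_indep_family {1..2 * n} \<phi> \<and> fun_space.span (\<phi> ` {1..2 * n}) = W \<and>
           (\<forall>i\<in>{1..n}. \<forall>r\<in>{1..n}.
              V r (\<phi> i) = (if i = r then 1 else 0) \<and> M r (\<phi> i) = 0 \<and>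
              V r (\<phi> (i + n)) = 0 \<and> M r (\<phi> (i + n)) = (if i = r then 1 else 0))"
    by (intro exI[of _ \<phi>]) blast
qed


section \<open>The vertex values and edge means as linear functionals\<close>

lemma linear_functional_on_vertex_value: "linear_functional_on W (vertex_value v r)"
  by (simp add: linear_functional_on_def vertex_value_def fun_scale_def)

lemma linear_functional_on_edge_mean:
  assumes "\<And>g. g \<in> W \<Longrightarrow> edge_integrable v j g"
  shows "linear_functional_on W (edge_mean v j)"
  unfolding linear_functional_on_def
proof (intro conjI ballI allI)
  fix g h assume "g \<in> W" "h \<in> W"
  then show "edge_mean v j (g + h) = edge_mean v j g + edge_mean v j h"
    using assms[of g] assms[of h]
    by (simp add: edge_mean_def edge_integrable_def add_divide_distrib)
qed (simp add: edge_mean_def fun_scale_def)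


section \<open>The affine functions on a triangle\<close>

text \<open>
  Adding \<open>g\<close> to a barycentric coordinate does not change its vertex values, and a barycentric
  coordinate is determined by them.
\<close>

lemma affine_fun_eq_0_if_vertices:
  assumes "nondegenerate v" "affine_fun g" "\<And>j. j \<in> {1..3} \<Longrightarrow> g (v j) = 0"
  shows "g x = 0"
proof -
  let ?h = "\<lambda>x. bary v 1 x + g x"
  obtain a b a' b' where "\<And>x. bary v 1 x = a \<bullet> x + b" "\<And>x. g x = a' \<bullet> x + b'"
    using affine_bary[OF assms(1), of 1] assms(2) unfolding affine_fun_def by metis
  then have "affine_fun ?h"
    unfolding affine_fun_def
    by (intro exI[of _ "a + a'"] exI[of _ "b + b'"]) (simp add: inner_left_distrib)
  then have "affine_fun ?h \<and> (\<forall>j\<in>{1..3}. ?h (v j) = (if cyc 1 = j then 1 else 0))"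
    using bary_vertex[OF assms(1), of _ 1] assms(3) by simp
  moreover have "affine_fun (bary v 1) \<and>
      (\<forall>j\<in>{1..3}. bary v 1 (v j) = (if cyc 1 = j then 1 else 0))"
    using affine_bary[OF assms(1)] bary_vertex[OF assms(1)] by blast
  ultimately have "?h = bary v 1"
    using bary_ex1[OF assms(1), of 1] by blast
  then show ?thesis
    by (metis add_cancel_right_right)
qed

lemma affine_fun_zero: "affine_fun (\<lambda>x. 0)"
  unfolding affine_fun_def by (intro exI[of _ 0]) simp

lemma affine_fun_add: "affine_fun g \<Longrightarrow> affine_fun h \<Longrightarrow> affine_fun (\<lambda>x. g x + h x)"
  unfolding affine_fun_def
proof (elim exE)
  fix a b c d assume "\<forall>x. g x = a \<bullet> x + b" "\<forall>x. h x = c \<bullet> x + d"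
  then show "\<exists>a b. \<forall>x. g x + h x = a \<bullet> x + b"
    by (intro exI[of _ "a + c"] exI[of _ "b + d"]) (simp add: inner_left_distrib)
qed

lemma affine_fun_scale: "affine_fun g \<Longrightarrow> affine_fun (\<lambda>x. c * g x)"
  unfolding affine_fun_def
proof (elim exE)
  fix a b assume "\<forall>x. g x = a \<bullet> x + b"
  then show "\<exists>a b. \<forall>x. c * g x = a \<bullet> x + b"
    by (intro exI[of _ "c *\<^sub>R a"] exI[of _ "c * b"]) (simp add: algebra_simps)
qed

lemma affine_fun_eq_bary_combination:
  assumes "nondegenerate v" "affine_fun g"
  shows "g x = (\<Sum>i\<in>{1..3}. g (v i) * bary v i x)"
proof -
  let ?h = "\<lambda>x. g x + ((- g (v 1)) * bary v 1 x +
                        ((- g (v 2)) * bary v 2 x + (- g (v 3)) * bary v 3 x))"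
  have "affine_fun ?h"
    by (intro affine_fun_add affine_fun_scale affine_bary assms)
  moreover have "?h (v j) = 0" if "j \<in> {1..3}" for j
    unfolding bary_vertex[OF assms(1) that] cyc_simps using that by (auto simp: atLeastAtMost_1_3)
  ultimately have "?h x = 0"
    by (rule affine_fun_eq_0_if_vertices[OF assms(1)])
  then show ?thesis by (simp add: atLeastAtMost_1_3)
qed

lemma P1_eq_span_bary:
  assumes "nondegenerate v"
  shows "P1 v = fun_space.span ((\<lambda>i. on_set (triangle v) (bary v i)) ` {1..3})"
proof (rule antisym)
  show "P1 v \<subseteq> fun_space.span ((\<lambda>i. on_set (triangle v) (bary v i)) ` {1..3})"
  proof
    fix p assume "p \<in> P1 v"
    then obtain g where "p = on_set (triangle v) g" "affine_fun g"
      unfolding P1_def by blast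
    then have "p x = (\<Sum>i\<in>{1..3}. fun_scale (g (v i)) (on_set (triangle v) (bary v i))) x" for x
      using affine_fun_eq_bary_combination[OF assms \<open>affine_fun g\<close>, of x]
      unfolding atLeastAtMost_1_3 by (simp add: on_set_def fun_scale_def)
    then have "p = (\<Sum>i\<in>{1..3}. fun_scale (g (v i)) (on_set (triangle v) (bary v i)))"
      by (rule ext)
    also have "\<dots> \<in> fun_space.span ((\<lambda>i. on_set (triangle v) (bary v i)) ` {1..3})"
      by (intro fun_space.span_sum fun_space.span_scale fun_space.span_base imageI)
    finally show "p \<in> fun_space.span ((\<lambda>i. on_set (triangle v) (bary v i)) ` {1..3})" .
  qed
  have "fun_space.subspace (P1 v)"
  proof (rule fun_space.subspaceI)
    show "0 \<in> P1 v"
      unfolding P1_def using affine_fun_zero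
      by (auto intro!: exI[of _ "\<lambda>x. 0"] simp: on_set_def fun_eq_iff)
    show "p + q \<in> P1 v" if pq: "p \<in> P1 v" "q \<in> P1 v" for p q
    proof -
      obtain g h where "p = on_set (triangle v) g" "affine_fun g" "q = on_set (triangle v) h" "affine_fun h"
        using pq unfolding P1_def by blast
      then show ?thesis
        unfolding P1_def using affine_fun_add[of g h]
        by (auto intro!: exI[of _ "\<lambda>x. g x + h x"] simp: on_set_def fun_eq_iff)
    qed
    show "fun_scale c p \<in> P1 v" if p: "p \<in> P1 v" for c p
    proof -
      obtain g where "p = on_set (triangle v) g" "affine_fun g"
        using p unfolding P1_def by blast
      then show ?thesis
        unfolding P1_def using affine_fun_scale[of g c]
        by (auto intro!: exI[of _ "\<lambda>x. c * g x"] simp: on_set_def fun_scale_def fun_eq_iff)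
    qed
  qed
  then show "fun_space.span ((\<lambda>i. on_set (triangle v) (bary v i)) ` {1..3}) \<subseteq> P1 v"
    using affine_bary[OF assms] by (intro fun_space.span_minimal) (auto simp: P1_def)
qed

lemma V_h_eq_span:
  assumes "nondegenerate v"
  shows "V_h v e = fun_space.span ((\<lambda>i. on_set (triangle v) (bary v i)) ` {1..3} \<union>
                                   (\<lambda>k. on_set (triangle v) (e k)) ` {1..3})"
  unfolding V_h_def fun_space.span_Un P1_eq_span_bary[OF assms] enrichment_span_def by blast


section \<open>The enrichment functions on the boundary of the triangle\<close>

lemma vertex_in_triangle: "i \<in> {1..3} \<Longrightarrow> v i \<in> triangle v"
  unfolding triangle_def by (auto intro: hull_inc)

lemma cyc_id: "i \<in> {1..3} \<Longrightarrow> cyc i = i"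
  unfolding atLeastAtMost_1_3 by auto

lemma cyc_distinct:
  assumes "j \<in> {1..3}"
  shows "cyc (j + 1) \<noteq> cyc (j + 2)" "cyc (j + 1) \<noteq> j" "cyc (j + 2) \<noteq> j"
proof -
  \<comment> \<open>Numeral arithmetic by explicit rewriting keeps the arguments of \<open>cyc\<close> in numeral form.\<close>
  have sums: "1 + 1 = (2::nat)" "1 + 2 = (3::nat)" "2 + 1 = (3::nat)" "2 + 2 = (4::nat)"
    "3 + 1 = (4::nat)" "3 + 2 = (5::nat)"
    by simp_all
  have neq: "1 \<noteq> (2::nat)" "2 \<noteq> (1::nat)" "1 \<noteq> (3::nat)" "3 \<noteq> (1::nat)"
    "2 \<noteq> (3::nat)" "3 \<noteq> (2::nat)"
    by simp_all
  consider "j = 1" | "j = 2" | "j = 3"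
    using assms by (auto simp: atLeastAtMost_1_3)
  then have "cyc (j + 1) \<noteq> cyc (j + 2) \<and> cyc (j + 1) \<noteq> j \<and> cyc (j + 2) \<noteq> j"
  proof cases
    case 1 show ?thesis unfolding 1 sums cyc_simps using neq by blast
  next
    case 2 show ?thesis unfolding 2 sums cyc_simps using neq by blast
  next
    case 3 show ?thesis unfolding 3 sums cyc_simps using neq by blast
  qed
  then show "cyc (j + 1) \<noteq> cyc (j + 2)" "cyc (j + 1) \<noteq> j" "cyc (j + 2) \<noteq> j" by blast+
qed

lemma edge_length_pos:
  assumes "nondegenerate v" "j \<in> {1..3}"
  shows "0 < edge_length v j"
proof -
  have "v (cyc (j + 1)) \<noteq> v (cyc (j + 2))"
  proof
    assume eq: "v (cyc (j + 1)) = v (cyc (j + 2))"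
    have "bary v (j + 1) (v (cyc (j + 1))) = 1"
      using bary_vertex[OF assms(1) cyc_in] by simp
    moreover have "bary v (j + 1) (v (cyc (j + 2))) = (if cyc (j + 1) = cyc (j + 2) then 1 else 0)"
      using bary_vertex[OF assms(1) cyc_in] by simp
    ultimately show False
      using eq cyc_distinct(1)[OF assms(2)] by simp
  qed
  then show ?thesis by (simp add: edge_length_def)
qed

lemma edge_path_affine:
  assumes "t = 1 - s / edge_length v j"
  shows "edge_path v j s = t *\<^sub>R v (cyc (j + 1)) + (1 - t) *\<^sub>R v (cyc (j + 2))"
  unfolding edge_path_def assms by (simp add: algebra_simps)

lemma edge_point_in_triangle:
  assumes "0 \<le> t" "t \<le> 1"
  shows "t *\<^sub>R v (cyc (j + 1)) + (1 - t) *\<^sub>R v (cyc (j + 2)) \<in> triangle v"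
proof -
  have "convex (triangle v)"
    unfolding triangle_def by (rule convex_convex_hull)
  then show ?thesis
    using vertex_in_triangle[OF cyc_in] assms by (intro convexD) auto
qed

lemma enrichment_vertex:
  assumes "nondegenerate v" "i \<in> {1..3}"
  shows "enrichment v \<mu> \<alpha> \<beta> f k (v i) = 0"
  using weight_vertex[OF assms] by (simp add: enrichment_def)

text \<open>
  For \<open>k \<noteq> j\<close> one of the indices \<open>k + 1\<close>, \<open>k + 2\<close> is \<open>j\<close> modulo 3, and \<open>\<lambda>\<^sub>j = 0\<close> on edge \<open>j\<close>; so
  one of the factors of \<open>e\<^sub>k\<close> is a value \<open>f\<^sub>l(0)\<close>.
\<close>

lemma enrichment_other_edge:
  assumes "nondegenerate v" "j \<in> {1..3}" "k \<in> {1..3}" "k \<noteq> j"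
    and "\<And>l. l \<in> {1..6} \<Longrightarrow> f l 0 = 0"
  shows "enrichment v \<mu> \<alpha> \<beta> f k (t *\<^sub>R v (cyc (j + 1)) + (1 - t) *\<^sub>R v (cyc (j + 2))) = 0"
    (is "enrichment v \<mu> \<alpha> \<beta> f k ?x = 0")
proof -
  have "k = 1 \<or> k = 2 \<or> k = 3" "j = 1 \<or> j = 2 \<or> j = 3"
    using assms(2,3) by auto
  then have on_edge: "cyc (k + 1) = j \<or> cyc (k + 2) = j"
    using assms(4) by (elim disjE) (simp_all add: cyc_def)
  have f_0: "f (2 * k - 1) 0 = 0" "f (2 * k) 0 = 0"
    using assms(3) by (auto intro!: assms(5))
  have bary_0: "bary v i (t *\<^sub>R v (cyc (j + 1)) + (1 - t) *\<^sub>R v (cyc (j + 2))) = 0"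
    if "cyc i = j" for i
    unfolding bary_edge[OF assms(1) cyc_in cyc_in] that
    by (simp only: cyc_distinct[OF assms(2), symmetric] if_False)
  show ?thesis
    unfolding enrichment_def using on_edge
  proof
    assume "cyc (k + 1) = j"
    show "weight v \<mu> \<alpha> \<beta> ?x * f (2 * k - 1) (bary v (k + 1) ?x) * f (2 * k) (bary v (k + 2) ?x) = 0"
      unfolding bary_0[OF \<open>cyc (k + 1) = j\<close>] f_0 mult_zero_right mult_zero_left ..
  next
    assume "cyc (k + 2) = j"
    show "weight v \<mu> \<alpha> \<beta> ?x * f (2 * k - 1) (bary v (k + 1) ?x) * f (2 * k) (bary v (k + 2) ?x) = 0"
      unfolding bary_0[OF \<open>cyc (k + 2) = j\<close>] f_0 mult_zero_right ..
  qed
qed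

lemma bary_own_edge:
  assumes "nondegenerate v" "j \<in> {1..3}"
  shows "bary v (j + 1) (t *\<^sub>R v (cyc (j + 1)) + (1 - t) *\<^sub>R v (cyc (j + 2))) = t"
    and "bary v (j + 2) (t *\<^sub>R v (cyc (j + 1)) + (1 - t) *\<^sub>R v (cyc (j + 2))) = 1 - t"
  unfolding bary_edge[OF assms(1) cyc_in cyc_in]
  by (simp_all only: cyc_distinct(1)[OF assms(2)] cyc_distinct(1)[OF assms(2), symmetric]
      if_True if_False)
    simp_all

lemma weight_nonneg: "0 \<le> weight v \<mu> \<alpha> \<beta> x"
  unfolding weight_def by (intro sum_nonneg mult_nonneg_nonneg) auto

lemma constant_sign_on_mult:
  assumes "constant_sign_on S g" "constant_sign_on S h"
  shows "constant_sign_on S (\<lambda>x. g x * h x)"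
  using assms unfolding constant_sign_on_def
  by (elim disjE) (simp_all add: mult_nonneg_nonpos mult_nonpos_nonneg mult_nonpos_nonpos)

lemma constant_sign_on_compose:
  assumes "constant_sign_on T g" "\<And>x. x \<in> S \<Longrightarrow> h x \<in> T"
  shows "constant_sign_on S (\<lambda>x. g (h x))"
  using assms unfolding constant_sign_on_def by blast

text \<open>
  A function of constant sign with zero integral vanishes almost everywhere. If its zeros form
  a null set, then the whole interval is null.
\<close>

lemma integral_ne_0_if_constant_sign:
  fixes g :: "real \<Rightarrow> real"
  assumes "a < b" "integrable (lebesgue_on {a..b}) g" "constant_sign_on {a..b} g"
    and "negligible {s \<in> {a..b}. g s = 0}"
  shows "integral\<^sup>L (lebesgue_on {a..b}) g \<noteq> 0"
proof
  assume 0: "integral\<^sup>L (lebesgue_on {a..b}) g = 0"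
  have "AE s in lebesgue_on {a..b}. g s = 0"
    using assms(3) unfolding constant_sign_on_def
  proof
    assume "\<forall>t\<in>{a..b}. 0 \<le> g t"
    then have "AE s in lebesgue_on {a..b}. 0 \<le> g s"
      by (intro AE_I2) simp
    then show ?thesis
      using integral_nonneg_eq_0_iff_AE[OF assms(2)] 0 by simp
  next
    assume "\<forall>t\<in>{a..b}. g t \<le> 0"
    then have "AE s in lebesgue_on {a..b}. 0 \<le> - g s"
      by (intro AE_I2) simp
    then show ?thesis
      using integral_nonneg_eq_0_iff_AE[of "lebesgue_on {a..b}" "\<lambda>s. - g s"] 0 assms(2) by simp
  qed
  then have "AE s in lebesgue. s \<in> {a..b} \<longrightarrow> g s = 0"
    by (subst (asm) AE_restrict_space_iff) auto
  moreover have "AE s in lebesgue. s \<notin> {s \<in> {a..b}. g s = 0}"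
    using assms(4) unfolding negligible_iff_null_sets by (rule AE_not_in)
  ultimately have "AE s in lebesgue. s \<notin> {a..b}"
    by eventually_elim auto
  then have "negligible {a..b}"
    by (simp add: negligible_iff_null_sets completion.null_sets_iff_AE)
  then show False
    using assms(1) negligible_interval(1)[of a b] by (simp add: box_real)
qed

lemma negligible_affine_preimage:
  fixes c d :: real
  assumes "negligible N" "c \<noteq> 0"
  shows "negligible {s. c * s + d \<in> N}"
proof -
  have "{s. c * s + d \<in> N} = (\<lambda>t. (t - d) / c) ` N"
    using assms(2) by (auto simp: image_iff intro!: bexI[of _ "c * x + d" for x])
  moreover have "(\<lambda>t. (t - d) / c) differentiable_on N"
    by (simp add: divide_inverse differentiable_on_def)
  ultimately show ?thesis
    using negligible_differentiable_image_negligible[OF _ assms(1)] by simp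
qed

lemma negligible_zeros_if_AE_ne_0:
  assumes "AE t in lebesgue_on {a..b::real}. g t \<noteq> (0::real)"
  shows "negligible {t \<in> {a..b}. g t = 0}"
proof -
  have "AE t in lebesgue. t \<notin> {t \<in> {a..b}. g t = 0}"
    using assms by (auto simp: AE_restrict_space_iff elim: eventually_mono)
  then show ?thesis
    unfolding negligible_iff_null_sets completion.null_sets_iff_AE by simp
qed

text \<open>
  In terms of arc length \<open>s\<close> on an edge of length \<open>L\<close>, the restriction of \<open>e\<^sub>j\<close> is the weight times
  \<open>f\<^sub>2\<^sub>j\<^sub>-\<^sub>1(1 - s / L) f\<^sub>2\<^sub>j(s / L)\<close>. Its zeros are the endpoints and the preimages, under affine maps, of
  the null sets of zeros of the two factors.
\<close>

lemma edge_mean_own_enrichment_ne_0: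
  assumes "nondegenerate v" "j \<in> {1..3}"
    and "\<And>l. l \<in> {1..6} \<Longrightarrow> constant_sign_on {0..1} (f l)"
    and "\<And>l. l \<in> {1..6} \<Longrightarrow> AE t in lebesgue_on {0..1}. f l t \<noteq> 0"
    and "edge_integrable v j (on_set (triangle v) (enrichment v \<mu> \<alpha> \<beta> f j))"
  shows "edge_mean v j (on_set (triangle v) (enrichment v \<mu> \<alpha> \<beta> f j)) \<noteq> 0"
proof -
  let ?L = "edge_length v j"
  let ?P = "\<lambda>s. edge_path v j s"
  let ?g = "\<lambda>s. on_set (triangle v) (enrichment v \<mu> \<alpha> \<beta> f j) (?P s)"
  let ?f = "f (2 * j - 1)" and ?h = "f (2 * j)"
  have idx: "2 * j - 1 \<in> {1..6}" "2 * j \<in> {1..6}"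
    using assms(2) by auto
  have L: "0 < ?L"
    by (rule edge_length_pos[OF assms(1,2)])
  have range: "1 - s / ?L \<in> {0..1}" "s / ?L \<in> {0..1}" if "s \<in> {0..?L}" for s
    using that L by (auto simp: field_simps)
  have g: "?g s = weight v \<mu> \<alpha> \<beta> (?P s) * ?f (1 - s / ?L) * ?h (s / ?L)" if "s \<in> {0..?L}" for s
    using range(1)[OF that] edge_point_in_triangle[of "1 - s / ?L" v j]
      bary_own_edge[OF assms(1,2), of "1 - s / ?L"]
    unfolding edge_path_affine[OF refl] on_set_def enrichment_def by simp
  have weight: "weight v \<mu> \<alpha> \<beta> (?P s) \<noteq> 0" if "0 < s" "s < ?L" for s
    using that weight_edge[OF assms(1,2), of "1 - s / ?L" \<mu> \<alpha> \<beta>]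
    unfolding edge_path_affine[OF refl] by simp
  have "constant_sign_on {0..?L} (\<lambda>s. weight v \<mu> \<alpha> \<beta> (?P s) * ?f (1 - s / ?L) * ?h (s / ?L))"
    using range
    by (intro constant_sign_on_mult constant_sign_on_compose[OF assms(3)[OF idx(1)]]
        constant_sign_on_compose[OF assms(3)[OF idx(2)]])
      (auto simp: constant_sign_on_def weight_nonneg)
  then have sign: "constant_sign_on {0..?L} ?g"
    using g unfolding constant_sign_on_def by simp
  let ?N = "\<lambda>g. {t \<in> {0..1::real}. g t = (0::real)}"
  have N: "negligible (?N ?f)" "negligible (?N ?h)"
    by (intro negligible_zeros_if_AE_ne_0 assms(4) idx)+
  have "negligible ({s. (- 1 / ?L) * s + 1 \<in> ?N ?f} \<union> {s. (1 / ?L) * s + 0 \<in> ?N ?h} \<union> {0, ?L})"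
    using L by (intro negligible_Un negligible_affine_preimage N negligible_finite) auto
  moreover have "{s \<in> {0..?L}. ?g s = 0} \<subseteq>
      {s. (- 1 / ?L) * s + 1 \<in> ?N ?f} \<union> {s. (1 / ?L) * s + 0 \<in> ?N ?h} \<union> {0, ?L}"
  proof
    fix s assume s: "s \<in> {s \<in> {0..?L}. ?g s = 0}"
    show "s \<in> {s. (- 1 / ?L) * s + 1 \<in> ?N ?f} \<union> {s. (1 / ?L) * s + 0 \<in> ?N ?h} \<union> {0, ?L}"
    proof (cases "s \<in> {0, ?L}")
      case True
      then show ?thesis by blast
    next
      case False
      with s weight[of s] g[of s] have "?f (1 - s / ?L) = 0 \<or> ?h (s / ?L) = 0"
        by auto
      with s range[of s] show ?thesis by auto
    qed
  qed
  ultimately have "negligible {s \<in> {0..?L}. ?g s = 0}"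
    by (rule negligible_subset)
  then have "integral\<^sup>L (lebesgue_on {0..?L}) ?g \<noteq> 0"
    using integral_ne_0_if_constant_sign[OF L _ sign] assms(5) unfolding edge_integrable_def by simp
  then show ?thesis
    using L by (simp add: edge_mean_def)
qed

lemma edge_mean_other_enrichment:
  assumes "nondegenerate v" "j \<in> {1..3}" "k \<in> {1..3}" "k \<noteq> j"
    and "\<And>l. l \<in> {1..6} \<Longrightarrow> f l 0 = 0"
  shows "edge_mean v j (on_set (triangle v) (enrichment v \<mu> \<alpha> \<beta> f k)) = 0"
proof -
  have "on_set (triangle v) (enrichment v \<mu> \<alpha> \<beta> f k) (edge_path v j s) = 0" for s
    unfolding edge_path_affine[OF refl] on_set_def
    by (simp only: enrichment_other_edge[where f = f, OF assms] if_cancel)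
  then show ?thesis
    by (simp add: edge_mean_def)
qed

section \<open>Admissibility\<close>

theorem theorem4p10:
  fixes v :: "nat \<Rightarrow> real^2" and f :: "nat \<Rightarrow> real \<Rightarrow> real" and \<mu> \<alpha> \<beta> :: real
  assumes "nondegenerate v"
    and "\<And>l. l \<in> {1..6} \<Longrightarrow> integrable (lebesgue_on {0..1}) (f l)"
    and "\<And>l. l \<in> {1..6} \<Longrightarrow> constant_sign_on {0..1} (f l)"
    and "\<And>l. l \<in> {1..6} \<Longrightarrow> AE t in lebesgue_on {0..1}. f l t \<noteq> 0"
    and "\<And>l. l \<in> {1..6} \<Longrightarrow> f l 0 = 0"
    and "\<mu> \<ge> 0" and "\<alpha> > -1" and "\<beta> > -1"
    and "functionals_well_defined v (enrichment v \<mu> \<alpha> \<beta> f)"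
  shows "admissible v (enrichment v \<mu> \<alpha> \<beta> f)"
proof -
  let ?e = "enrichment v \<mu> \<alpha> \<beta> f"
  define p where "p i = on_set (triangle v) (bary v i)" for i
  define q where "q k = on_set (triangle v) (?e k)" for k
  let ?W = "fun_space.span (p ` {1..3} \<union> q ` {1..3})"
  have integrable: "edge_integrable v j g" if "g \<in> ?W" "j \<in> {1..3}" for g j
    using assms(9) that unfolding functionals_well_defined_def p_def q_def by blast
  have p_vertex: "vertex_value v r (p i) = (if i = r then 1 else 0)"
    if "i \<in> {1..3}" "r \<in> {1..3}" for i r
    using vertex_in_triangle[OF that(2), of v]
    by (simp add: p_def on_set_def vertex_value_def bary_vertex[OF assms(1) that(2)] cyc_id[OF that(1)])
  have q_vertex: "vertex_value v r (q k) = 0" if "k \<in> {1..3}" "r \<in> {1..3}" for k r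
    by (simp add: q_def on_set_def vertex_value_def enrichment_vertex[OF assms(1) that(2)])
  have q_mean: "edge_mean v s (q k) = 0 \<longleftrightarrow> k \<noteq> s" if "k \<in> {1..3}" "s \<in> {1..3}" for k s
  proof (cases "k = s")
    case True
    have "edge_integrable v s (q s)"
      using that(2) by (intro integrable fun_space.span_base) auto
    then show ?thesis
      using True edge_mean_own_enrichment_ne_0[OF assms(1) that(2) assms(3,4)] unfolding q_def by simp
  next
    case False
    then show ?thesis
      using edge_mean_other_enrichment[where f = f, OF assms(1) that(2,1) False assms(5)] by (simp add: q_def)
  qed
  note basis = dual_basis_of_block_triangular[of 3 p q "vertex_value v" "edge_mean v",
      OF linear_functional_on_vertex_value linear_functional_on_edge_mean[OF integrable]
      p_vertex q_vertex q_mean]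
  \<comment> \<open>The sum of the two spaces is direct, since the vertices already separate affine functions.\<close>
  have "g = 0" if "g \<in> P1 v" "g \<in> enrichment_span v ?e" for g
  proof -
    obtain a where a: "g = on_set (triangle v) a" "affine_fun a"
      using \<open>g \<in> P1 v\<close> unfolding P1_def by blast
    have vertex_0: "vertex_value v r g = 0" if "r \<in> {1..3}" for r
      using linear_functional_on_vanishes_on_span[OF linear_functional_on_vertex_value
          fun_space.subspace_UNIV, of "q ` {1..3}" v r g] q_vertex that \<open>g \<in> enrichment_span v ?e\<close>
      unfolding enrichment_span_def q_def by blast
    have "a (v r) = 0" if "r \<in> {1..3}" for r
      using vertex_0[OF that] vertex_in_triangle[OF that, of v] by (simp add: a(1) vertex_value_def on_set_def)
    then have "a x = 0" for x
      by (rule affine_fun_eq_0_if_vertices[OF assms(1) a(2)])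
    then show "g = 0"
      by (simp add: a(1) on_set_def fun_eq_iff)
  qed
  moreover have "0 \<in> P1 v \<inter> enrichment_span v ?e"
    unfolding P1_eq_span_bary[OF assms(1)] enrichment_span_def by (simp add: fun_space.span_zero)
  ultimately have "P1 v \<inter> enrichment_span v ?e = {0}"
    by blast
  moreover have "lin_indep_family {1..3} (\<lambda>k. on_set (triangle v) (?e k))"
    unfolding q_def[symmetric] by (rule basis(1))
  moreover have "V_h v ?e = ?W"
    unfolding V_h_eq_span[OF assms(1)] p_def q_def ..
  moreover have "\<exists>\<phi>. lin_indep_family {1..6} \<phi> \<and> fun_space.span (\<phi> ` {1..6}) = ?W \<and>
        (\<forall>i\<in>{1..3}. \<forall>j\<in>{1..3}. \<forall>r\<in>{1..3}. \<forall>s\<in>{1..3}.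
           vertex_value v r (\<phi> i) = (if i = r then 1 else 0) \<and>
           edge_mean v s (\<phi> i) = 0 \<and>
           vertex_value v r (\<phi> (j + 3)) = 0 \<and>
           edge_mean v s (\<phi> (j + 3)) = (if j = s then 1 else 0))"
  proof -
    have six: "2 * 3 = (6::nat)" by simp
    have "\<exists>\<phi>. lin_indep_family {1..6} \<phi> \<and> fun_space.span (\<phi> ` {1..6}) = ?W \<and>
        (\<forall>i\<in>{1..3}. \<forall>r\<in>{1..3}.
           vertex_value v r (\<phi> i) = (if i = r then 1 else 0) \<and> edge_mean v r (\<phi> i) = 0 \<and>
           vertex_value v r (\<phi> (i + 3)) = 0 \<and>
           edge_mean v r (\<phi> (i + 3)) = (if i = r then 1 else 0))"
      by (rule basis(2)[unfolded six])
    then obtain \<phi> where "lin_indep_family {1..6} \<phi>" "fun_space.span (\<phi> ` {1..6}) = ?W"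
      and "\<forall>i\<in>{1..3}. \<forall>r\<in>{1..3}.
        vertex_value v r (\<phi> i) = (if i = r then 1 else 0) \<and> edge_mean v r (\<phi> i) = 0 \<and>
        vertex_value v r (\<phi> (i + 3)) = 0 \<and>
        edge_mean v r (\<phi> (i + 3)) = (if i = r then 1 else 0)"
      by (elim exE conjE)
    then show ?thesis
      by (intro exI[of _ \<phi>] conjI ballI) (blast dest: bspec)+
  qed
  ultimately show ?thesis
    unfolding admissible_def by (simp only: simp_thms)
qed

end
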